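(* Let $\mathcal H$ be a complex Hilbert space, $A$ a positive bounded operator on $\mathcal H$, and let $S\in\mathbb B_A(\mathcal H)$ have closed range, with Moore–Penrose inverse $S^\dagger$. Then $$r_A(S)\le\frac14\Big(\sqrt{\big(\|S^2S^\dagger\|_A-\|S^\dagger S^2\|_A\big)^2+4\|S^2\|_A\|S^\dagger S^2S^\dagger\|_A}+\|S^2S^\dagger\|_A+\|S^\dagger S^2\|_A\Big).$$
   Context: For a positive bounded operator $A$ on $\mathcal H$: $\|z\|_A=\langle Az,z\rangle^{1/2}$ and $\|S\|_A=\sup\{\|Sz\|_A:\|z\|_A=1\}\in[0,+\infty]$ for bounded $S$ (the right-hand side of the claim is read as $+\infty$ if $\|S^2S^\dagger\|_A$ or $\|S^\dagger S^2\|_A$ is infinite). $\mathbb B_A(\mathcal H)$ is the set of bounded operators $S$ on $\mathcal H$ admitting an $A$-adjoint, i.e. a bounded $R$ with $AR=S^*A$; for such $S$ the seminorm is finite. The $A$-spectral radius of $S\in\mathbb B_A(\mathcal H)$ is $r_A(S)=\lim_{n\to\infty}\|S^n\|_A^{1/n}$. *)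

theory Defs
  imports "HOL-Analysis.Analysis"
begin

text \<open>
  Complex inner product spaces are built on top of \<^class>\<open>real_inner\<close>: the complex structure extends
  the given real one, and the real inner product is the real part of the complex one. Hence
  positivity and \<^prop>\<open>norm x = sqrt (Re (cinner x x))\<close> are inherited. The inner product is linear in
  its first argument.
\<close>

class complex_inner = real_inner +
  fixes scaleC :: "complex \<Rightarrow> 'a \<Rightarrow> 'a"  (infixr "*\<^sub>C" 75)
    and cinner :: "'a \<Rightarrow> 'a \<Rightarrow> complex"
  assumes scaleC_add_right: "c *\<^sub>C (x + y) = c *\<^sub>C x + c *\<^sub>C y"
    and scaleC_add_left: "(c + d) *\<^sub>C x = c *\<^sub>C x + d *\<^sub>C x"
    and scaleC_scaleC: "c *\<^sub>C d *\<^sub>C x = (c * d) *\<^sub>C x"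
    and scaleC_of_real: "complex_of_real r *\<^sub>C x = r *\<^sub>R x"
    and cinner_commute: "cinner x y = cnj (cinner y x)"
    and cinner_add_left: "cinner (x + y) z = cinner x z + cinner y z"
    and cinner_scaleC_left: "cinner (c *\<^sub>C x) y = c * cinner x y"
    and Re_cinner: "Re (cinner x y) = inner x y"

class chilbert_space = complex_inner + complete_space

lemma norm_eq_sqrt_cinner: "norm (x :: 'a :: complex_inner) = sqrt (Re (cinner x x))"
  by (simp add: Re_cinner norm_eq_sqrt_inner)

lemma cinner_self_real: "cinner (x :: 'a :: complex_inner) x \<in> \<real>"
  by (metis Reals_cnj_iff cinner_commute)

instantiation complex :: chilbert_space
begin

definition scaleC_complex :: "complex \<Rightarrow> complex \<Rightarrow> complex"
  where "scaleC_complex c x = c * x"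

definition cinner_complex :: "complex \<Rightarrow> complex \<Rightarrow> complex"
  where "cinner_complex x y = x * cnj y"

instance
  by standard
    (simp_all add: scaleC_complex_def cinner_complex_def algebra_simps inner_complex_def scaleR_conv_of_real)

end

definition bounded_clinear :: "('a::complex_inner \<Rightarrow> 'a) \<Rightarrow> bool"
  where "bounded_clinear T \<longleftrightarrow> bounded_linear T \<and> (\<forall>c x. T (c *\<^sub>C x) = c *\<^sub>C T x)"

definition positive_operator :: "('a::complex_inner \<Rightarrow> 'a) \<Rightarrow> bool"
  where "positive_operator A \<longleftrightarrow>
    bounded_clinear A \<and> (\<forall>z. cinner (A z) z \<in> \<real> \<and> 0 \<le> Re (cinner (A z) z))"

text \<open>Every bounded operator on a Hilbert space has an adjoint (Riesz), and it is unique.\<close>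

definition cadjoint :: "('a::chilbert_space \<Rightarrow> 'a) \<Rightarrow> 'a \<Rightarrow> 'a"
  where "cadjoint T = (THE R. \<forall>x y. cinner (R x) y = cinner x (T y))"

lemma cadjoint_eqI:
  fixes T R :: "'a::chilbert_space \<Rightarrow> 'a"
  assumes "\<And>x y. cinner (R x) y = cinner x (T y)"
  shows "cadjoint T = R"
  unfolding cadjoint_def
proof (rule the_equality)
  show "\<forall>x y. cinner (R x) y = cinner x (T y)" using assms by blast
next
  fix Q assume Q: "\<forall>x y. cinner (Q x) y = cinner x (T y)"
  show "Q = R"
  proof
    fix x
    have "inner (Q x) y = inner (R x) y" for y
      using Q assms by (metis Re_cinner)
    then have "inner (Q x - R x) (Q x - R x) = 0" by (simp add: inner_diff_left)
    then show "Q x = R x" by simp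
  qed
qed

definition moore_penrose :: "('a::chilbert_space \<Rightarrow> 'a) \<Rightarrow> ('a \<Rightarrow> 'a) \<Rightarrow> bool"
  where "moore_penrose S X \<longleftrightarrow> bounded_clinear X \<and>
    S \<circ> X \<circ> S = S \<and> X \<circ> S \<circ> X = X \<and>
    cadjoint (S \<circ> X) = S \<circ> X \<and> cadjoint (X \<circ> S) = X \<circ> S"

text \<open>A bounded \<^term>\<open>S\<close> has exactly one bounded Moore-Penrose inverse if its range is closed, and none
  otherwise.\<close>

definition mp_inverse :: "('a::chilbert_space \<Rightarrow> 'a) \<Rightarrow> 'a \<Rightarrow> 'a"
  where "mp_inverse S = (THE X. moore_penrose S X)"

definition A_norm :: "('a::chilbert_space \<Rightarrow> 'a) \<Rightarrow> 'a \<Rightarrow> real"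
  where "A_norm A z = sqrt (Re (cinner (A z) z))"

text \<open>The supremum is taken in \<open>[0, \<infinity>]\<close>; in particular it is \<open>0\<close> when \<^term>\<open>A\<close> is zero and
  there is no \<^term>\<open>z\<close> with \<^prop>\<open>A_norm A z = 1\<close>.\<close>

definition A_opnorm :: "('a::chilbert_space \<Rightarrow> 'a) \<Rightarrow> ('a \<Rightarrow> 'a) \<Rightarrow> ennreal"
  where "A_opnorm A S = (SUP z\<in>{z. A_norm A z = 1}. ennreal (A_norm A (S z)))"

definition A_adjointable :: "('a::chilbert_space \<Rightarrow> 'a) \<Rightarrow> ('a \<Rightarrow> 'a) set"
  where "A_adjointable A =
    {S. bounded_clinear S \<and> (\<exists>R. bounded_clinear R \<and> A \<circ> R = cadjoint S \<circ> A)}"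

text \<open>Meant for \<^prop>\<open>S \<in> A_adjointable A\<close>, for which all the seminorms involved are finite, so that
  \<^const>\<open>enn2real\<close> loses nothing.\<close>

definition A_spectral_radius :: "('a::chilbert_space \<Rightarrow> 'a) \<Rightarrow> ('a \<Rightarrow> 'a) \<Rightarrow> real"
  where "A_spectral_radius A S = lim (\<lambda>n. root n (enn2real (A_opnorm A (S ^^ n))))"

end

theory Submission
  imports Defs
begin

text \<open>
  Write \<open>X\<close> for \<open>S\<^sup>\<dagger>\<close> and \<open>r\<close> for \<open>r\<^sub>A(S)\<close>. Since \<open>S X S = S\<close>, the powers of \<open>S\<close> factor as
  \<open>S\<^bsup>n+1\<^esup> = (S\<^sup>2 X)\<^sup>n S\<close>, \<open>S\<^bsup>n+1\<^esup> = S (X S\<^sup>2)\<^sup>n\<close> and \<open>S\<^bsup>2n+1\<^esup> = (S\<^sup>2 (X S\<^sup>2 X))\<^sup>n S\<close>. Hence \<open>r \<le> p\<close>,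
  \<open>r \<le> q\<close> and \<open>r\<^sup>2 \<le> m t\<close> hold separately, and these three bounds imply the claim because
  \<open>p + q \<ge> 2 r\<close> and the square root is at least \<open>2 r\<close>. What needs work is that the objects exist:
  that \<open>X\<close> is bounded comes from the closed graph theorem; that \<open>S\<close> is bounded for the seminorm of
  \<open>A\<close> from the log-convexity of \<open>k \<mapsto> \<parallel>P\<^sup>k z\<parallel>\<^sub>A\<close>, where \<open>P = R S\<close> for an \<open>A\<close>-adjoint \<open>R\<close> of \<open>S\<close>; and the
  limit defining \<open>r\<close> exists by submultiplicativity.
\<close>

instance chilbert_space \<subseteq> banach ..

section \<open>Closed graph theorem\<close>

text \<open>Successive approximation: every remainder is approximated by a vector with controlled
  image, up to half its norm. So \<open>y\<close> is the sum of the corrections, their images are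
  dominated by a geometric series, and the closed graph carries \<open>T\<close> through the
  sum.\<close>

lemma closed_graph_norm_bound:
  fixes T :: "'a::banach \<Rightarrow> 'b::banach"
  assumes lin: "linear T"
    and graph: "\<And>f x y. f \<longlonglongrightarrow> x \<Longrightarrow> (\<lambda>n. T (f n)) \<longlonglongrightarrow> y \<Longrightarrow> T x = y"
    and approx: "\<And>y e. e > 0 \<Longrightarrow> \<exists>w. norm (T w) \<le> K * norm y \<and> norm (y - w) \<le> e"
  shows "norm (T y) \<le> 2 * K * norm y"
proof (cases "y = 0")
  case True
  then show ?thesis using lin by (simp add: linear_0)
next
  case False
  interpret T: linear T by (fact lin)
  have "\<exists>w. norm (T w) \<le> K * norm x \<and> norm (x - w) \<le> norm x / 2" for x
  proof (cases "x = 0")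
    case True
    then show ?thesis by (intro exI[of _ 0]) (simp add: T.zero)
  next
    case False
    then show ?thesis using approx[of "norm x / 2" x] by simp
  qed
  then obtain w where w: "\<And>x. norm (T (w x)) \<le> K * norm x" "\<And>x. norm (x - w x) \<le> norm x / 2"
    by metis
  have "0 \<le> K * norm y" using w(1)[of y] norm_ge_zero order_trans by blast
  then have K: "0 \<le> K" using False by (simp add: zero_le_mult_iff)
  \<comment> \<open>\<open>e k\<close> is the remainder of \<open>y\<close> after \<open>k\<close>
    corrections.\<close>
  define e where "e k = ((\<lambda>x. x - w x) ^^ k) y" for k
  have e_Suc: "e (Suc k) = e k - w (e k)" for k by (simp add: e_def)
  have e0: "e 0 = y" by (simp add: e_def)
  have e_le: "norm (e k) \<le> norm y * (1/2) ^ k" for k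
  proof (induction k)
    case (Suc k)
    then show ?case using w(2)[of "e k"] by (simp add: e_Suc)
  qed (simp add: e0)
  have partial: "(\<Sum>k<n. w (e k)) = y - e n" for n
    by (induction n) (simp_all add: e0 e_Suc)
  have "(\<lambda>k. norm y * (1/2) ^ k) \<longlonglongrightarrow> norm y * 0"
    by (intro tendsto_intros LIMSEQ_power_zero) auto
  then have "e \<longlonglongrightarrow> 0"
    using e_le by (intro Lim_null_comparison[of e]) auto
  then have lim1: "(\<lambda>n. \<Sum>k<n. w (e k)) \<longlonglongrightarrow> y"
    unfolding partial using tendsto_diff[OF tendsto_const, of e 0 sequentially y] by simp
  have bnd: "norm (T (w (e k))) \<le> K * norm y * (1/2) ^ k" for k
    using w(1)[of "e k"] mult_left_mono[OF e_le[of k] K] by (simp add: mult.assoc)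
  have geo: "(\<lambda>k. K * norm y * (1/2) ^ k) sums (K * norm y * 2)"
    using sums_mult[OF geometric_sums[of "1/2 :: real"], of "K * norm y"] by simp
  have sn: "summable (\<lambda>k. norm (T (w (e k))))"
    by (rule summable_comparison_test[OF _ sums_summable[OF geo]]) (use bnd in auto)
  then have "(\<lambda>n. \<Sum>k<n. T (w (e k))) \<longlonglongrightarrow> (\<Sum>k. T (w (e k)))"
    by (rule summable_LIMSEQ[OF summable_norm_cancel])
  then have "T y = (\<Sum>k. T (w (e k)))"
    by (intro graph[OF lim1, unfolded T.sum])
  also have "norm \<dots> \<le> (\<Sum>k. norm (T (w (e k))))"
    by (rule summable_norm[OF sn])
  also have "\<dots> \<le> (\<Sum>k. K * norm y * (1/2) ^ k)"
    by (rule suminf_le[OF bnd sn sums_summable[OF geo]])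
  also have "\<dots> = 2 * K * norm y" using sums_unique[OF geo] by simp
  finally show ?thesis .
qed

text \<open>The contrapositive of Baire's theorem, moved from metrics on a carrier set to the type
  class.\<close>

lemma closed_cover_interior_nonempty:
  fixes F :: "nat \<Rightarrow> 'a::{metric_space, complete_space} set"
  assumes "\<And>n. closed (F n)" and "(\<Union>n. F n) = UNIV"
  obtains n where "interior (F n) \<noteq> {}"
proof -
  have "mcomplete_of (metric (UNIV :: 'a set, dist))"
    by (simp add: mcomplete_of_def Met_TC.mcomplete_def complete_UNIV)
  then have mc: "Met_TC.mcomplete TYPE('a)"
    by (simp add: mcomplete_of_def)
  show thesis
  proof (rule ccontr)
    assume "\<not> thesis"
    then have "interior (F n) = {}" for n using that by blast
    then have "interior (\<Union> (range F)) = {}"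
      using Met_TC.metric_Baire_category_alt[OF mc, of "range F"] assms(1) by auto
    then show False using assms(2) by simp
  qed
qed

text \<open>By Baire, some sublevel set of \<open>norm (T y)\<close> is dense in a ball. Convexity
  and symmetry move the ball to the origin, and rescaling gives the approximation hypothesis of
  \<open>closed_graph_norm_bound\<close>.\<close>

theorem closed_graph_theorem:
  fixes T :: "'a::banach \<Rightarrow> 'b::banach"
  assumes lin: "linear T"
    and graph: "\<And>f x y. f \<longlonglongrightarrow> x \<Longrightarrow> (\<lambda>n. T (f n)) \<longlonglongrightarrow> y \<Longrightarrow> T x = y"
  shows "bounded_linear T"
proof -
  interpret T: linear T by (fact lin)
  define B where "B n = {y. norm (T y) \<le> real n}" for n
  have "(\<Union>n. closure (B n)) = UNIV"
  proof -
    have "y \<in> B (nat \<lceil>norm (T y)\<rceil>)" for y by (simp add: B_def real_nat_ceiling_ge)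
    then show ?thesis using closure_subset by blast
  qed
  then obtain n where "interior (closure (B n)) \<noteq> {}"
    using closed_cover_interior_nonempty[of "\<lambda>n. closure (B n)", OF closed_closure] by blast
  then obtain y0 r where r: "r > 0" and ball: "ball y0 r \<subseteq> closure (B n)"
    by (meson ex_in_conv mem_interior)
  have conv: "convex (closure (B n))"
  proof (intro convex_closure convexI)
    fix x y :: 'a and u v :: real
    assume xy: "x \<in> B n" "y \<in> B n" and uv: "0 \<le> u" "0 \<le> v" "u + v = 1"
    have "norm (T (u *\<^sub>R x + v *\<^sub>R y)) \<le> u * norm (T x) + v * norm (T y)"
      using uv by (simp add: T.add T.scale norm_triangle_le)
    also have "\<dots> \<le> u * real n + v * real n"
      using xy uv by (intro add_mono mult_left_mono) (auto simp: B_def)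
    also have "\<dots> = real n" using uv by (simp flip: distrib_right)
    finally show "u *\<^sub>R x + v *\<^sub>R y \<in> B n" by (simp add: B_def)
  qed
  have neg: "- y \<in> closure (B n)" if "y \<in> closure (B n)" for y
  proof -
    obtain f where f: "\<And>k. f k \<in> B n" and lim: "f \<longlonglongrightarrow> y"
      using \<open>y \<in> closure (B n)\<close> closure_sequential by metis
    have "- f k \<in> B n" for k using f by (simp add: B_def T.neg)
    then show ?thesis
      unfolding closure_sequential using tendsto_minus[OF lim] by (intro exI[of _ "\<lambda>k. - f k"]) simp
  qed
  \<comment> \<open>\<open>y\<close> is the midpoint of \<open>y0 + y\<close> and
    \<open>y - y0\<close>, and the latter is the reflection of a point of the ball about
    \<open>y0\<close>.\<close>
  have small: "y \<in> closure (B n)" if "norm y < r" for y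
  proof -
    have "y0 + y \<in> closure (B n)" using that ball by (auto simp: dist_norm)
    moreover have "y0 - y \<in> closure (B n)" using that ball by (auto simp: dist_norm)
    then have "y - y0 \<in> closure (B n)" using neg by fastforce
    ultimately have "(1/2) *\<^sub>R (y0 + y) + (1/2) *\<^sub>R (y - y0) \<in> closure (B n)"
      by (intro convexD[OF conv]) auto
    moreover have "(1/2) *\<^sub>R (y0 + y) + (1/2) *\<^sub>R (y - y0) = y"
      by (simp add: algebra_simps flip: scaleR_add_left)
    ultimately show ?thesis by simp
  qed
  \<comment> \<open>Dividing a nonzero \<open>y\<close> by \<open>s = 2 * norm y / r\<close> gives
    it norm \<open>r / 2\<close>, inside the ball. An approximant in \<open>B n\<close>, scaled back
    by \<open>s\<close>, has an image of norm at most
    \<open>s * real n = K * norm y\<close>.\<close>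
  define K where "K = 2 * real n / r"
  have approx: "\<exists>w. norm (T w) \<le> K * norm y \<and> norm (y - w) \<le> e" if e: "e > 0" for y e
  proof (cases "y = 0")
    case True
    then show ?thesis using e by (intro exI[of _ 0]) (simp add: T.zero)
  next
    case False
    define s where "s = 2 * norm y / r"
    have s: "s > 0" using False r by (simp add: s_def)
    have "norm (inverse s *\<^sub>R y) < r"
      using s r False by (simp add: s_def field_simps)
    then obtain w where w: "w \<in> B n" "dist w (inverse s *\<^sub>R y) < e / s"
      using small closure_approachable s e by (metis divide_pos_pos)
    have "norm (T (s *\<^sub>R w)) \<le> s * real n"
      using w(1) s by (simp add: T.scale B_def)
    moreover have "s * real n = K * norm y" by (simp add: s_def K_def)
    moreover have "y - s *\<^sub>R w = s *\<^sub>R (inverse s *\<^sub>R y - w)" using s by (simp add: algebra_simps)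
    then have "norm (y - s *\<^sub>R w) = s * dist w (inverse s *\<^sub>R y)"
      using s by (simp add: dist_norm norm_minus_commute)
    then have "norm (y - s *\<^sub>R w) \<le> e" using w(2) s by (simp add: field_simps)
    ultimately show ?thesis by metis
  qed
  have "norm (T y) \<le> norm y * (2 * K)" for y
    using closed_graph_norm_bound[OF lin graph approx] by (simp add: mult_ac)
  then show ?thesis
    by (intro bounded_linear_intro[of T "2 * K"]) (simp_all add: T.add T.scale)
qed

section \<open>Orthogonal projection and adjoints\<close>

text \<open>A minimizing sequence for the distance from \<open>x\<close> to \<open>V\<close> is
  Cauchy by the parallelogram law, so a nearest point \<open>u\<close> exists. The obtuse-angle
  inequality at \<open>u + w\<close> and at \<open>u - w\<close> gives orthogonality.\<close>

lemma subspace_orthogonal_decomposition: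
  fixes V :: "'a::{real_inner, complete_space} set"
  assumes V: "subspace V" and "closed V"
  obtains v where "v \<in> V" and "\<And>w. w \<in> V \<Longrightarrow> inner (x - v) w = 0"
proof -
  have V0: "V \<noteq> {}" using V subspace_0 by auto
  define d where "d = infdist x V"
  have d: "d \<le> norm (x - v)" if "v \<in> V" for v
    using infdist_le[OF that, of x] by (simp add: d_def dist_norm)
  have d0: "0 \<le> d" by (simp add: d_def infdist_nonneg)
  \<comment> \<open>The slack is put on the squared distance because the parallelogram law compares
    squares.\<close>
  have "\<exists>v\<in>V. (norm (x - v))\<^sup>2 < d\<^sup>2 + 1 / real (Suc n)" for n
  proof (rule ccontr)
    assume "\<not> ?thesis"
    then have "sqrt (d\<^sup>2 + 1 / real (Suc n)) \<le> dist x v" if "v \<in> V" for v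
      using that by (auto simp: dist_norm not_less intro!: real_le_lsqrt)
    then have "sqrt (d\<^sup>2 + 1 / real (Suc n)) \<le> d"
      unfolding d_def infdist_def using V0 by (auto intro: cINF_greatest)
    then have "d\<^sup>2 + 1 / real (Suc n) \<le> d\<^sup>2"
      by (rule sqrt_le_D)
    then show False by (simp add: field_simps)
  qed
  then obtain v where vV: "\<And>n. v n \<in> V" and v: "\<And>n. (norm (x - v n))\<^sup>2 < d\<^sup>2 + 1 / real (Suc n)"
    by metis
  have par: "(norm (v m - v n))\<^sup>2 \<le> 2 / real (Suc m) + 2 / real (Suc n)" for m n
  proof -
    have "(1/2) *\<^sub>R (v m + v n) \<in> V" using V vV by (simp add: subspace_add subspace_scale)
    then have "d\<^sup>2 \<le> (norm (x - (1/2) *\<^sub>R (v m + v n)))\<^sup>2" using d d0 by (intro power_mono) auto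
    moreover have "(norm (v m - v n))\<^sup>2 + 4 * (norm (x - (1/2) *\<^sub>R (v m + v n)))\<^sup>2
        = 2 * (norm (x - v m))\<^sup>2 + 2 * (norm (x - v n))\<^sup>2"
      by (simp add: power2_norm_eq_inner inner_diff_left inner_diff_right inner_add_left
          inner_add_right inner_commute algebra_simps)
    ultimately show ?thesis using v[of m] v[of n] by simp
  qed
  have "Cauchy v"
  proof (rule metric_CauchyI)
    fix e :: real assume e: "e > 0"
    obtain N where N: "4 / e\<^sup>2 < real N" using reals_Archimedean2 by blast
    have "dist (v m) (v n) < e" if "m \<ge> N" "n \<ge> N" for m n
    proof -
      have "real N > 0" using N e by (meson divide_pos_pos less_trans zero_less_numeral zero_less_power)
      then have "2 / real (Suc m) + 2 / real (Suc n) < 2 / real N + 2 / real N"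
        using that by (intro add_strict_mono divide_strict_left_mono) auto
      also have "\<dots> < e\<^sup>2" using N e \<open>real N > 0\<close> by (simp add: field_simps)
      finally have "(norm (v m - v n))\<^sup>2 < e\<^sup>2" using par[of m n] by simp
      then show ?thesis using e by (simp add: dist_norm power2_less_imp_less)
    qed
    then show "\<exists>N. \<forall>m\<ge>N. \<forall>n\<ge>N. dist (v m) (v n) < e" by blast
  qed
  then obtain u where u: "v \<longlonglongrightarrow> u" by (auto simp: Cauchy_convergent_iff convergent_def)
  then have uV: "u \<in> V" using \<open>closed V\<close> vV closed_sequentially by blast
  have "(\<lambda>n. (norm (x - v n))\<^sup>2) \<longlonglongrightarrow> (norm (x - u))\<^sup>2"
    by (intro tendsto_intros u)
  moreover have "(\<lambda>n. d\<^sup>2 + 1 / real (Suc n)) \<longlonglongrightarrow> d\<^sup>2 + 0"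
    by (intro tendsto_add tendsto_const LIMSEQ_inverse_real_of_nat[unfolded inverse_eq_divide])
  ultimately have "(norm (x - u))\<^sup>2 \<le> d\<^sup>2 + 0"
    by (rule LIMSEQ_le) (meson v less_imp_le)
  then have "norm (x - u) \<le> d" using d0 power2_le_imp_le by force
  then have closest: "\<forall>z\<in>V. dist x u \<le> dist x z" using d by (force simp: dist_norm)
  have "inner (x - u) w = 0" if w: "w \<in> V" for w
  proof -
    have "inner (x - u) (y - u) \<le> 0" if "y \<in> V" for y
      using any_closest_point_dot[OF subspace_imp_convex[OF V] \<open>closed V\<close> uV that closest] .
    from this[of "u + w"] this[of "u - w"] have "inner (x - u) w \<le> 0" "inner (x - u) (- w) \<le> 0"
      using V uV w by (simp_all add: subspace_add subspace_diff)
    then show ?thesis by simp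
  qed
  then show thesis using that uV by blast
qed

text \<open>A nonzero functional has a vector \<open>u\<close> orthogonal to its kernel with
  \<open>f u \<noteq> 0\<close>, and every \<open>y\<close> differs from a multiple of
  \<open>u\<close> by an element of the kernel.\<close>

lemma riesz_representation:
  fixes f :: "'a::{real_inner, complete_space} \<Rightarrow> real"
  assumes "bounded_linear f"
  obtains u where "\<And>y. f y = inner u y"
proof (cases "\<forall>y. f y = 0")
  case True
  then show thesis using that[of 0] by simp
next
  case False
  interpret f: bounded_linear f by fact
  obtain x where x: "f x \<noteq> 0" using False by blast
  have "closed (f -` {0})"
    by (intro continuous_closed_vimage) (auto intro: f.isCont)
  moreover have "subspace (f -` {0})"
    by (simp add: subspace_def f.zero f.add f.scale)
  ultimately obtain v where v: "v \<in> f -` {0}" and orth: "\<And>w. w \<in> f -` {0} \<Longrightarrow> inner (x - v) w = 0"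
    using subspace_orthogonal_decomposition[of "f -` {0}" x] by metis
  define u where "u = x - v"
  have fu: "f u \<noteq> 0" using x v by (simp add: u_def f.diff)
  then have u0: "inner u u \<noteq> 0" using f.zero by auto
  have "f y = inner ((f u / inner u u) *\<^sub>R u) y" for y
  proof -
    have "inner u (y - (f y / f u) *\<^sub>R u) = 0"
      using orth[folded u_def] fu by (simp add: f.diff f.scale)
    then show ?thesis using u0 fu by (simp add: inner_diff_right field_simps)
  qed
  then show thesis using that by blast
qed


section \<open>From the real to the complex inner product\<close>

lemma inner_scaleC_imaginary_unit:
  fixes x y :: "'a::complex_inner"
  shows "inner x (\<i> *\<^sub>C y) = Im (cinner x y)"
proof -
  have "cinner x (\<i> *\<^sub>C y) = cnj (cinner (\<i> *\<^sub>C y) x)" by (rule cinner_commute)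
  also have "\<dots> = - \<i> * cinner x y"
    by (simp add: cinner_scaleC_left cinner_commute[of x y])
  finally have "Re (cinner x (\<i> *\<^sub>C y)) = Im (cinner x y)" by simp
  then show ?thesis by (simp only: Re_cinner)
qed

text \<open>The imaginary part of \<open>cinner u y\<close> is the real inner product of
  \<open>u\<close> with i times \<open>y\<close>. Since \<open>T\<close> commutes with scalars, the
  real identity for all \<open>y\<close> contains the imaginary one.\<close>

lemma cinner_eqI_inner:
  fixes T :: "'a::complex_inner \<Rightarrow> 'a"
  assumes "\<And>c y. T (c *\<^sub>C y) = c *\<^sub>C T y" and inner: "\<And>y. inner u y = inner x (T y)"
  shows "cinner u y = cinner x (T y)"
proof (rule complex_eqI)
  show "Re (cinner u y) = Re (cinner x (T y))" by (simp only: Re_cinner inner)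
  show "Im (cinner u y) = Im (cinner x (T y))"
    by (simp only: inner_scaleC_imaginary_unit[symmetric] inner assms(1))
qed

lemma inner_scaleC_left:
  fixes x y :: "'a::complex_inner"
  shows "inner (c *\<^sub>C x) y = inner x (cnj c *\<^sub>C y)"
proof -
  have "cinner x (cnj c *\<^sub>C y) = cnj (cinner (cnj c *\<^sub>C y) x)" by (rule cinner_commute)
  also have "\<dots> = cinner (c *\<^sub>C x) y"
    by (simp add: cinner_scaleC_left cinner_commute[of x y])
  finally have "Re (cinner x (cnj c *\<^sub>C y)) = Re (cinner (c *\<^sub>C x) y)" by (rule arg_cong)
  then show ?thesis by (simp only: Re_cinner)
qed

text \<open>Riesz representation produces an operator with this property, and
  \<open>cadjoint_eqI\<close> identifies it with the definite description.\<close>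

lemma inner_cadjoint:
  fixes T :: "'a::chilbert_space \<Rightarrow> 'a"
  assumes "bounded_clinear T"
  shows "inner (cadjoint T x) y = inner x (T y)"
proof -
  have bl: "bounded_linear T" and C: "\<And>c y. T (c *\<^sub>C y) = c *\<^sub>C T y"
    using assms by (auto simp: bounded_clinear_def)
  have "\<exists>u. \<forall>y. inner u y = inner x (T y)" for x
    using riesz_representation[OF bounded_linear_compose[OF bounded_linear_inner_right bl], of x]
    by metis
  then obtain R where R: "\<And>x y. inner (R x) y = inner x (T y)" by metis
  then have "cadjoint T = R" by (intro cadjoint_eqI cinner_eqI_inner C)
  then show ?thesis using R by simp
qed

section \<open>The Moore--Penrose inverse\<close>

lemma inner_cadjoint_fixed:
  fixes T :: "'a::chilbert_space \<Rightarrow> 'a"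
  assumes "bounded_clinear T" and "cadjoint T = T"
  shows "inner (T x) y = inner x (T y)"
  using inner_cadjoint[OF assms(1), of x y] assms(2) by simp

lemma bounded_clinear_comp:
  "bounded_clinear S \<Longrightarrow> bounded_clinear T \<Longrightarrow> bounded_clinear (S \<circ> T)"
  by (simp add: bounded_clinear_def bounded_linear_compose comp_def)

text \<open>\<open>S X\<close> and \<open>S Y\<close> are self-adjoint idempotents with the same
  range, hence equal; \<open>X S\<close> and \<open>Y S\<close> agree likewise, having the same
  kernel. So \<open>X = X S X = X S Y = Y S Y = Y\<close>.\<close>

lemma moore_penrose_unique:
  fixes S :: "'a::chilbert_space \<Rightarrow> 'a"
  assumes S: "bounded_clinear S" and X: "moore_penrose S X" and Y: "moore_penrose S Y"
  shows "X = Y"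
proof -
  have eqs: "S (Z (S x)) = S x" "Z (S (Z x)) = Z x"
      "inner (S (Z x)) y = inner x (S (Z y))" "inner (Z (S x)) y = inner x (Z (S y))"
    if "moore_penrose S Z" for Z x y
  proof -
    have Z: "bounded_clinear Z" and e: "S \<circ> Z \<circ> S = S" "Z \<circ> S \<circ> Z = Z"
      and a: "cadjoint (S \<circ> Z) = S \<circ> Z" "cadjoint (Z \<circ> S) = Z \<circ> S"
      using that by (auto simp: moore_penrose_def)
    show "S (Z (S x)) = S x" "Z (S (Z x)) = Z x"
      using e by (auto dest: fun_cong[of _ _ x])
    show "inner (S (Z x)) y = inner x (S (Z y))" "inner (Z (S x)) y = inner x (Z (S y))"
      using inner_cadjoint_fixed[OF bounded_clinear_comp[OF S Z] a(1)]
        inner_cadjoint_fixed[OF bounded_clinear_comp[OF Z S] a(2)] by simp_all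
  qed
  note eX = eqs[OF X] and eY = eqs[OF Y]
  have SX: "S (X x) = S (Y x)" for x
  proof (rule vector_eq_ldot[THEN iffD1], rule allI)
    fix y
    have "inner y (S (X x)) = inner (S (X y)) x" by (simp add: eX)
    also have "\<dots> = inner (S (Y (S (X y)))) x" by (simp add: eY)
    also have "\<dots> = inner y (S (X (S (Y x))))" by (simp only: eX(3) eY(3))
    finally show "inner y (S (X x)) = inner y (S (Y x))" by (simp only: eX(1))
  qed
  have XS: "X (S x) = Y (S x)" for x
  proof (rule vector_eq_ldot[THEN iffD1], rule allI)
    fix y
    have "inner y (X (S x)) = inner (X (S y)) x" by (simp add: eX)
    also have "\<dots> = inner (X (S (Y (S y)))) x" by (simp add: eY)
    also have "\<dots> = inner y (Y (S (X (S x))))" by (simp only: eX(4) eY(4))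
    finally show "inner y (X (S x)) = inner y (Y (S x))" by (simp only: eX(1))
  qed
  show ?thesis
  proof
    fix x
    have "X x = X (S (X x))" by (simp add: eX)
    also have "\<dots> = Y (S (Y x))" by (simp only: SX XS)
    finally show "X x = Y x" by (simp add: eY)
  qed
qed

text \<open>\<open>X y\<close> is the vector orthogonal to the kernel of \<open>S\<close> that \<open>S\<close> maps to the orthogonal
  projection of \<open>y\<close> to the range; both conditions are closed in \<open>(y, X y)\<close>, so the closed graph
  theorem yields the boundedness of \<open>X\<close>.\<close>

lemma moore_penrose_exists:
  fixes S :: "'a::chilbert_space \<Rightarrow> 'a"
  assumes S: "bounded_clinear S" and cl: "closed (range S)"
  obtains X where "moore_penrose S X"
proof -
  have bl: "bounded_linear S" and SC: "\<And>c x. S (c *\<^sub>C x) = c *\<^sub>C S x"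
    using S by (auto simp: bounded_clinear_def)
  interpret S: bounded_linear S by (fact bl)
  have ker: "subspace {n. S n = 0}" "closed {n. S n = 0}"
    by (auto simp: subspace_def S.zero S.add S.scale intro!: closed_Collect_eq S.continuous_on continuous_intros)
  have ran: "subspace (range S)"
    by (rule linear_subspace_image[OF S.linear_axioms subspace_UNIV])
  define G where "G y u \<longleftrightarrow> (\<forall>n. S n = 0 \<longrightarrow> inner u n = 0) \<and> (\<forall>x. inner (y - S u) (S x) = 0)" for y u
  have G_ex: "\<exists>u. G y u" for y
  proof -
    obtain v where v: "v \<in> range S" "\<And>w. w \<in> range S \<Longrightarrow> inner (y - v) w = 0"
      using subspace_orthogonal_decomposition[OF ran cl, of y] by metis
    then obtain x where x: "v = S x" by blast
    \<comment> \<open>Removing the kernel component from a preimage keeps its image and makes it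
      orthogonal to the kernel.\<close>
    obtain n where n: "n \<in> {n. S n = 0}" "\<And>w. w \<in> {n. S n = 0} \<Longrightarrow> inner (x - n) w = 0"
      using subspace_orthogonal_decomposition[OF ker, of x] by metis
    have "G y (x - n)" using n v by (auto simp: G_def S.diff x)
    then show ?thesis ..
  qed
  \<comment> \<open>The difference of two solutions lies in the kernel, because its image is
    orthogonal to itself, and it is also orthogonal to the kernel. Uniqueness is what makes
    \<open>X\<close> linear.\<close>
  have G_unique: "u = u'" if "G y u" "G y u'" for y u u'
  proof -
    have "inner (S (u - u')) (S (u - u')) = inner (y - S u') (S (u - u')) - inner (y - S u) (S (u - u'))"
      by (simp add: S.diff inner_diff_left)
    also have "\<dots> = 0" using that by (simp add: G_def)
    finally have "S (u - u') = 0" by simp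
    then have "inner u (u - u') = 0" "inner u' (u - u') = 0" using that by (auto simp: G_def)
    then have "inner (u - u') (u - u') = 0" by (simp add: inner_diff_left)
    then show ?thesis by simp
  qed
  obtain X where X: "\<And>y. G y (X y)" using G_ex by metis
  have X_eq: "X y = u" if "G y u" for y u using G_unique[OF X that] .
  have G_add: "G (y + y') (u + u')" if "G y u" "G y' u'" for y y' u u'
  proof -
    have "(y + y') - S (u + u') = (y - S u) + (y' - S u')" by (simp add: S.add)
    then show ?thesis using that by (simp only: G_def inner_add_left) simp
  qed
  have G_scaleC: "G (c *\<^sub>C y) (c *\<^sub>C u)" if "G y u" for c y u
  proof -
    have "c *\<^sub>C y = c *\<^sub>C (y - S u) + c *\<^sub>C S u" by (simp flip: scaleC_add_right)
    then have diff: "c *\<^sub>C y - S (c *\<^sub>C u) = c *\<^sub>C (y - S u)" by (simp add: SC)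
    have "S (cnj c *\<^sub>C n) = 0" if "S n = 0" for n
      using that scaleC_add_right[of "cnj c" 0 "0::'a"] by (simp add: SC)
    then show ?thesis
      using that unfolding G_def diff inner_scaleC_left SC[symmetric] by simp
  qed
  have G_scaleR: "G (r *\<^sub>R y) (r *\<^sub>R u)" if "G y u" for r y u
    using G_scaleC[OF that, of "complex_of_real r"] by (simp add: scaleC_of_real)
  have lin: "linear X"
    by (rule linearI) (auto intro!: X_eq G_add G_scaleR X)
  have "bounded_linear X"
  proof (rule closed_graph_theorem[OF lin])
    fix f y u assume f: "f \<longlonglongrightarrow> y" and Xf: "(\<lambda>n. X (f n)) \<longlonglongrightarrow> u"
    have "inner u n = 0" if "S n = 0" for n
    proof -
      have "(\<lambda>k. inner (X (f k)) n) \<longlonglongrightarrow> inner u n" by (intro tendsto_intros Xf)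
      moreover have "(\<lambda>k. inner (X (f k)) n) = (\<lambda>k. 0)" using X that by (auto simp: G_def)
      ultimately show ?thesis by (simp add: LIMSEQ_const_iff)
    qed
    moreover have "inner (y - S u) (S x) = 0" for x
    proof -
      have "(\<lambda>k. inner (f k - S (X (f k))) (S x)) \<longlonglongrightarrow> inner (y - S u) (S x)"
        by (intro tendsto_intros f S.tendsto Xf)
      moreover have "(\<lambda>k. inner (f k - S (X (f k))) (S x)) = (\<lambda>k. 0)" using X by (auto simp: G_def)
      ultimately show ?thesis by (simp add: LIMSEQ_const_iff)
    qed
    ultimately show "X y = u" by (intro X_eq) (simp add: G_def)
  qed
  then have Xbc: "bounded_clinear X"
    by (auto simp: bounded_clinear_def intro!: X_eq G_scaleC X)
  have SXS: "S (X (S x)) = S x" for x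
  proof -
    have "inner (S x - S (X (S x))) (S (x - X (S x))) = 0"
      using X[of "S x"] unfolding G_def by blast
    then show ?thesis by (simp add: S.diff)
  qed
  have XSX: "X (S (X y)) = X y" for y
    using X[of y] by (intro X_eq) (simp add: G_def)
  \<comment> \<open>Residuals \<open>y - S (X y)\<close> are orthogonal to the range of
    \<open>S\<close>, so both sides equal \<open>inner (S (X x)) (S (X y))\<close>.\<close>
  have SX_sym: "inner (S (X x)) y = inner x (S (X y))" for x y
  proof -
    have "inner (y - S (X y)) (S (X x)) = 0" "inner (x - S (X x)) (S (X y)) = 0"
      using X by (auto simp: G_def)
    then show ?thesis by (simp add: inner_diff_left) (metis inner_commute)
  qed
  \<comment> \<open>Here the residual \<open>y - X (S y)\<close> lies in the kernel of
    \<open>S\<close>, to which all values of \<open>X\<close> are orthogonal.\<close>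
  have XS_sym: "inner (X (S x)) y = inner x (X (S y))" for x y
  proof -
    have "inner (X (S x)) (y - X (S y)) = 0" "inner (X (S y)) (x - X (S x)) = 0"
      using X SXS by (auto simp: G_def S.diff)
    then show ?thesis by (simp add: inner_diff_right) (metis inner_commute)
  qed
  have XC: "X (c *\<^sub>C y) = c *\<^sub>C X y" for c y using Xbc by (simp add: bounded_clinear_def)
  have "moore_penrose S X"
    unfolding moore_penrose_def
    by (auto simp: Xbc SXS XSX SC XC SX_sym XS_sym intro!: cadjoint_eqI cinner_eqI_inner)
  then show thesis by (rule that)
qed

lemma moore_penrose_mp_inverse:
  fixes S :: "'a::chilbert_space \<Rightarrow> 'a"
  assumes "bounded_clinear S" and "closed (range S)"
  shows "moore_penrose S (mp_inverse S)"
  unfolding mp_inverse_def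
  by (metis moore_penrose_exists[OF assms] moore_penrose_unique[OF assms(1)] theI)

section \<open>The seminorm of a positive operator\<close>

locale positive_form =
  fixes A :: "'a::chilbert_space \<Rightarrow> 'a"
  assumes positive: "positive_operator A"
begin

sublocale A: bounded_linear A
  using positive by (simp add: positive_operator_def bounded_clinear_def)

lemma form_nonneg: "0 \<le> inner (A x) x"
  using positive by (simp add: positive_operator_def Re_cinner)

text \<open>Symmetry comes from the complex diagonal being real: polarizing its vanishing imaginary
  part at \<open>x + w\<close> and then putting w equal to i times \<open>y\<close> gives the
  claim.\<close>

lemma form_commute: "inner (A x) y = inner (A y) x"
proof -
  have C: "A (c *\<^sub>C z) = c *\<^sub>C A z" for c z
    using positive by (simp add: positive_operator_def bounded_clinear_def)
  have i_i: "\<i> *\<^sub>C \<i> *\<^sub>C z = - z" for z :: 'a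
    using scaleC_of_real[of "-1" z] by (simp add: scaleC_scaleC)
  have imag: "inner (A z) (\<i> *\<^sub>C z) = 0" for z
    using positive by (simp add: positive_operator_def inner_scaleC_imaginary_unit complex_is_Real_iff)
  have "inner (A x) (\<i> *\<^sub>C w) + inner (A w) (\<i> *\<^sub>C x) = 0" for w
    using imag[of "x + w"] imag[of x] imag[of w]
    by (simp add: A.add scaleC_add_right inner_add_left inner_add_right)
  from this[of "\<i> *\<^sub>C y"] have "inner (\<i> *\<^sub>C A y) (\<i> *\<^sub>C x) = inner (A x) y"
    by (simp add: i_i C)
  moreover have "cnj \<i> *\<^sub>C \<i> *\<^sub>C x = x"
    using scaleC_of_real[of 1 x] by (simp add: scaleC_scaleC)
  ultimately show ?thesis by (simp add: inner_scaleC_left)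
qed

lemma A_norm_nonneg [simp]: "0 \<le> A_norm A x"
  by (simp add: A_norm_def Re_cinner form_nonneg)

lemma A_norm_square: "(A_norm A x)\<^sup>2 = inner (A x) x"
  by (simp add: A_norm_def Re_cinner form_nonneg)

lemma A_norm_scaleR: "A_norm A (r *\<^sub>R x) = \<bar>r\<bar> * A_norm A x"
proof (rule power2_eq_imp_eq)
  show "(A_norm A (r *\<^sub>R x))\<^sup>2 = (\<bar>r\<bar> * A_norm A x)\<^sup>2"
    unfolding A_norm_square power_mult_distrib by (simp add: A.scaleR power2_eq_square)
qed simp_all

text \<open>The form is nonnegative at \<open>s *\<^sub>R x - t *\<^sub>R y\<close>. With two
  weights, either coefficient can run freely when the seminorm of its vector vanishes, as may happen
  for a nonzero vector.\<close>

lemma A_norm_Cauchy_Schwarz: "inner (A x) y \<le> A_norm A x * A_norm A y"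
proof -
  have sq: "0 \<le> s\<^sup>2 * (A_norm A x)\<^sup>2 - 2 * s * t * inner (A x) y + t\<^sup>2 * (A_norm A y)\<^sup>2" for s t
  proof -
    have "0 \<le> inner (A (s *\<^sub>R x - t *\<^sub>R y)) (s *\<^sub>R x - t *\<^sub>R y)" by (rule form_nonneg)
    also have "\<dots> = s\<^sup>2 * inner (A x) x - 2 * s * t * inner (A x) y + t\<^sup>2 * inner (A y) y"
      by (simp add: A.diff A.scaleR inner_diff_left inner_diff_right form_commute[of y x]
          power2_eq_square algebra_simps)
    finally show ?thesis by (simp add: A_norm_square)
  qed
  show ?thesis
  proof (cases "A_norm A x * A_norm A y = 0")
    case True
    show ?thesis
    proof (rule ccontr)
      assume "\<not> ?thesis"
      then have pos: "inner (A x) y > 0" using True by simp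
      \<comment> \<open>A nonconstant affine function of \<open>s\<close> is unbounded
        below.\<close>
      have no: False if "c \<ge> 0" "\<And>s. 0 \<le> c - 2 * s * inner (A x) y" for c
        using that(2)[of "(c + 1) / inner (A x) y"] that(1) pos by simp
      from True consider "A_norm A x = 0" | "A_norm A y = 0" by auto
      then show False
      proof cases
        case 1
        then show False using no[of "(A_norm A y)\<^sup>2"] sq[of _ 1] by simp
      next
        case 2
        then show False using no[of "(A_norm A x)\<^sup>2"] sq[of 1] by simp
      qed
    qed
  next
    case False
    then have pos: "A_norm A x * A_norm A y > 0" by (simp add: less_le)
    \<comment> \<open>Each vector is weighted by the seminorm of the other, so that the two square
      terms agree and the form factors.\<close>
    have "0 \<le> 2 * (A_norm A x * A_norm A y) * (A_norm A x * A_norm A y - inner (A x) y)"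
      using sq[of "A_norm A y" "A_norm A x"] by (simp add: power2_eq_square algebra_simps)
    then show ?thesis using pos by (simp add: zero_le_mult_iff)
  qed
qed

lemma A_norm_triangle: "A_norm A (x + y) \<le> A_norm A x + A_norm A y"
proof (rule power2_le_imp_le)
  have "(A_norm A (x + y))\<^sup>2 = (A_norm A x)\<^sup>2 + 2 * inner (A x) y + (A_norm A y)\<^sup>2"
    unfolding A_norm_square by (simp add: A.add inner_add_left inner_add_right form_commute[of y x])
  also have "\<dots> \<le> (A_norm A x + A_norm A y)\<^sup>2"
    using A_norm_Cauchy_Schwarz[of x y] by (simp add: power2_sum)
  finally show "(A_norm A (x + y))\<^sup>2 \<le> (A_norm A x + A_norm A y)\<^sup>2" .
qed simp

lemma A_norm_diff_le: "A_norm A x \<le> A_norm A (x + y) + A_norm A y"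
  using A_norm_triangle[of "x + y" "- y"] A_norm_scaleR[of "-1" y] by simp

lemma A_opnorm_le:
  assumes "\<And>z. A_norm A (T z) \<le> c * A_norm A z"
  shows "A_opnorm A T \<le> ennreal c"
  unfolding A_opnorm_def
proof (rule SUP_least)
  fix z assume "z \<in> {z. A_norm A z = 1}"
  then show "ennreal (A_norm A (T z)) \<le> ennreal c" using assms[of z] by (simp add: ennreal_leI)
qed

text \<open>Off the null vectors this is homogeneity. Adding any multiple of a null vector
  \<open>z\<close> to a unit vector gives a unit vector again, so the seminorms of the multiples of
  \<open>T z\<close> are bounded and \<open>T z\<close> is null too. Without unit vectors the
  seminorm is zero.\<close>

lemma A_norm_le_A_opnorm:
  assumes lin: "linear T" and fin: "A_opnorm A T \<noteq> \<infinity>"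
  shows "A_norm A (T z) \<le> enn2real (A_opnorm A T) * A_norm A z"
proof -
  interpret T: linear T by (fact lin)
  define c where "c = enn2real (A_opnorm A T)"
  have unit: "A_norm A (T z) \<le> c" if "A_norm A z = 1" for z
  proof -
    have "ennreal (A_norm A (T z)) \<le> A_opnorm A T"
      unfolding A_opnorm_def using that by (intro SUP_upper) simp
    also have "\<dots> = ennreal c" using fin by (simp add: c_def less_top)
    finally show ?thesis by (simp add: c_def)
  qed
  show ?thesis
  proof (cases "A_norm A z = 0")
    case False
    have "A_norm A (inverse (A_norm A z) *\<^sub>R z) = 1" using False by (simp add: A_norm_scaleR)
    then have "A_norm A (T (inverse (A_norm A z) *\<^sub>R z)) \<le> c" by (rule unit)
    then show ?thesis
      using False A_norm_nonneg[of z] by (simp add: T.scale A_norm_scaleR c_def field_simps)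
  next
    case z: True
    have "A_norm A (T z) = 0"
    proof (cases "\<exists>w. A_norm A w \<noteq> 0")
      case True
      then obtain w' where w': "A_norm A w' \<noteq> 0" by blast
      define w where "w = inverse (A_norm A w') *\<^sub>R w'"
      have w: "A_norm A w = 1" using w' by (simp add: w_def A_norm_scaleR)
      have "r * A_norm A (T z) \<le> 2 * c" if "r \<ge> 0" for r
      proof -
        have "A_norm A (r *\<^sub>R z) = 0" using z by (simp add: A_norm_scaleR)
        then have "A_norm A (r *\<^sub>R z + w) = 1"
          using A_norm_triangle[of "r *\<^sub>R z" w] A_norm_diff_le[of w "r *\<^sub>R z"] w
          by (simp add: add.commute)
        then have "A_norm A (T (r *\<^sub>R z + w)) \<le> c" "A_norm A (T w) \<le> c" using unit w by auto
        then have "A_norm A (T (r *\<^sub>R z)) \<le> 2 * c"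
          using A_norm_diff_le[of "T (r *\<^sub>R z)" "T w"] by (simp add: T.add)
        then show ?thesis using that by (simp add: T.scale A_norm_scaleR)
      qed
      from this[of "(2 * c + 1) / A_norm A (T z)"] show ?thesis
        by (rule_tac ccontr) (simp add: c_def)
    qed auto
    then show ?thesis using z by simp
  qed
qed

end

text \<open>Ratios of successive terms do not decrease. A first ratio \<open>q > M\<close> would
  force growth at least like \<open>q ^ k\<close>, against the bound.\<close>

lemma log_convex_first_ratio_le:
  fixes a :: "nat \<Rightarrow> real"
  assumes nonneg: "\<And>k. 0 \<le> a k"
    and conv: "\<And>k. (a (Suc k))\<^sup>2 \<le> a k * a (Suc (Suc k))"
    and bound: "\<And>k. a k \<le> C * M ^ k" and M: "0 \<le> M"
  shows "a 1 \<le> M * a 0"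
proof (rule ccontr)
  assume gt: "\<not> ?thesis"
  have a0: "a 0 > 0"
  proof (rule ccontr)
    assume "\<not> a 0 > 0"
    then have "a 0 = 0" using nonneg[of 0] by simp
    then show False using gt conv[of 0] by simp
  qed
  define q where "q = a 1 / a 0"
  have q: "q > M" using gt a0 by (simp add: q_def field_simps)
  then have q0: "q > 0" using M by simp
  have step: "a k > 0 \<and> q * a k \<le> a (Suc k)" for k
  proof (induction k)
    case 0
    then show ?case using a0 by (simp add: q_def)
  next
    case (Suc k)
    then have pos: "a (Suc k) > 0" using q0 by (meson less_le_trans mult_pos_pos)
    have "q * a k * a (Suc k) \<le> a (Suc k) * a (Suc k)" using Suc pos by (intro mult_right_mono) auto
    also have "\<dots> \<le> a k * a (Suc (Suc k))" using conv[of k] by (simp add: power2_eq_square)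
    finally show ?case using Suc pos by (simp add: mult.assoc mult.left_commute)
  qed
  have lower: "a 0 * q ^ k \<le> a k" for k
  proof (induction k)
    case (Suc k)
    then have "q * (a 0 * q ^ k) \<le> q * a k" using q0 by (intro mult_left_mono) auto
    then show ?case using step[of k] by (simp add: mult.left_commute)
  qed simp
  have "(\<lambda>k. C * (M / q) ^ k) \<longlonglongrightarrow> C * 0"
    using q q0 M by (intro tendsto_mult tendsto_const LIMSEQ_power_zero) simp
  moreover have "a 0 \<le> C * (M / q) ^ k" for k
    using order_trans[OF lower[of k] bound[of k]] q0 by (simp add: power_divide field_simps)
  ultimately have "a 0 \<le> C * 0" by (intro LIMSEQ_le_const) auto
  then show False using a0 by simp
qed

text \<open>\<open>P = R \<circ> S\<close> is symmetric for the form, so Cauchy-Schwarz makes the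
  seminorms of \<open>(P ^^ k) z\<close> log-convex, and they grow at most like \<open>M ^ k\<close>
  for a norm bound \<open>M\<close> of \<open>P\<close>. Thus \<open>P\<close> has seminorm bound
  \<open>M\<close>, and \<open>S\<close> has seminorm bound \<open>sqrt M\<close>.\<close>

lemma (in positive_form) A_adjointable_bounded:
  assumes "S \<in> A_adjointable A"
  obtains c where "0 \<le> c" and "\<And>z. A_norm A (S z) \<le> c * A_norm A z"
proof -
  obtain R where S: "bounded_clinear S" and R: "bounded_clinear R" and RS: "A \<circ> R = cadjoint S \<circ> A"
    using assms by (auto simp: A_adjointable_def)
  define P where "P = R \<circ> S"
  have "bounded_linear P"
    using bounded_clinear_comp[OF R S] by (simp add: bounded_clinear_def P_def)
  then interpret P: bounded_linear P .
  have AP: "inner (A (P x)) y = inner (A (S x)) (S y)" for x y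
    using RS inner_cadjoint[OF S] by (simp add: P_def fun_eq_iff)
  have P_sym: "inner (A (P x)) y = inner (A x) (P y)" for x y
    by (metis AP form_commute)
  define a where "a z k = A_norm A ((P ^^ k) z)" for z k
  obtain M where M: "0 \<le> M" "\<And>x. norm (P x) \<le> norm x * M"
    using P.nonneg_bounded by blast
  obtain N where N: "0 \<le> N" "\<And>x. norm (A x) \<le> norm x * N"
    using A.nonneg_bounded by blast
  have norm_pow: "norm ((P ^^ k) z) \<le> norm z * M ^ k" for k z
  proof (induction k)
    case (Suc k)
    have "norm (P ((P ^^ k) z)) \<le> norm ((P ^^ k) z) * M" by (rule M)
    also have "\<dots> \<le> norm z * M ^ k * M" using Suc M by (intro mult_right_mono)
    finally show ?case by (simp add: mult_ac)
  qed simp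
  \<comment> \<open>The prefactor may depend on \<open>z\<close>: only the growth rate
    \<open>M\<close> enters the conclusion of \<open>log_convex_first_ratio_le\<close>.\<close>
  have a_bound: "a z k \<le> (sqrt N * norm z) * M ^ k" for z k
  proof -
    have "(A_norm A x)\<^sup>2 \<le> (sqrt N * norm x)\<^sup>2" for x
    proof -
      have "inner (A x) x \<le> norm (A x) * norm x" by (rule norm_cauchy_schwarz)
      also have "\<dots> \<le> norm x * N * norm x" using N by (intro mult_right_mono) auto
      also have "\<dots> = (sqrt N * norm x)\<^sup>2"
        using N by (simp add: power_mult_distrib) (simp add: power2_eq_square)
      finally show ?thesis by (simp only: A_norm_square)
    qed
    then have "A_norm A x \<le> sqrt N * norm x" for x
      by (rule power2_le_imp_le) (simp add: N)
    then have "a z k \<le> sqrt N * norm ((P ^^ k) z)" by (simp add: a_def)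
    also have "\<dots> \<le> sqrt N * (norm z * M ^ k)" using norm_pow N by (intro mult_left_mono) auto
    finally show ?thesis by (simp add: mult.assoc)
  qed
  have conv: "(a z (Suc k))\<^sup>2 \<le> a z k * a z (Suc (Suc k))" for z k
  proof -
    \<comment> \<open>One factor \<open>P\<close> moves from the left argument of the form to the
      right one.\<close>
    have "(a z (Suc k))\<^sup>2 = inner (A ((P ^^ k) z)) ((P ^^ Suc (Suc k)) z)"
      by (simp add: a_def A_norm_square P_sym)
    also have "\<dots> \<le> a z k * a z (Suc (Suc k))" unfolding a_def by (rule A_norm_Cauchy_Schwarz)
    finally show ?thesis .
  qed
  have "A_norm A (S z) \<le> sqrt M * A_norm A z" for z
  proof (rule power2_le_imp_le)
    have "(A_norm A (S z))\<^sup>2 = inner (A (P z)) z" by (simp add: A_norm_square AP)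
    also have "\<dots> \<le> a z 1 * a z 0" using A_norm_Cauchy_Schwarz[of "P z" z] by (simp add: a_def)
    also have "\<dots> \<le> (M * a z 0) * a z 0"
      by (intro mult_right_mono log_convex_first_ratio_le[OF _ conv a_bound M(1)]) (simp_all add: a_def)
    also have "\<dots> = (sqrt M * A_norm A z)\<^sup>2"
      using M by (simp add: a_def power_mult_distrib power2_eq_square)
    finally show "(A_norm A (S z))\<^sup>2 \<le> (sqrt M * A_norm A z)\<^sup>2" .
  qed (simp add: M)
  then show thesis using that[of "sqrt M"] M by simp
qed

section \<open>The spectral radius\<close>

text \<open>Fekete's lemma: the limit is the infimum. For \<open>c\<close> above it some
  \<open>k\<close> has \<open>a k \<le> c ^ k\<close>, and division of \<open>n\<close> by
  \<open>k\<close> with remainder gives \<open>a n \<le> C * c ^ n\<close>. Using roots instead of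
  logarithms admits zero terms.\<close>

lemma root_submultiplicative_convergent:
  fixes a :: "nat \<Rightarrow> real"
  assumes nonneg: "\<And>n. 0 \<le> a n" and submult: "\<And>m n. a (m + n) \<le> a m * a n"
  shows "convergent (\<lambda>n. root n (a n))"
proof -
  define L where "L = (INF n\<in>{1..}. root n (a n))"
  have bdd: "bdd_below ((\<lambda>n. root n (a n)) ` {1..})"
    by (rule bdd_belowI[of _ 0]) (auto simp: nonneg)
  have L_le: "L \<le> root n (a n)" if "n \<ge> 1" for n
    unfolding L_def using that by (intro cINF_lower bdd) auto
  have L0: "0 \<le> L" unfolding L_def by (intro cINF_greatest) (auto simp: nonneg)
  have upper: "\<forall>\<^sub>F n in sequentially. root n (a n) < y" if y: "y > L" for y
  proof -
    obtain c where c: "L < c" "c < y" using dense y by blast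
    then have c0: "c > 0" using L0 by simp
    obtain k where k: "k \<ge> 1" "root k (a k) < c"
      using cINF_less_iff[OF _ bdd, of c] c(1) by (auto simp: L_def)
    have "(root k (a k)) ^ k \<le> c ^ k" using k nonneg by (intro power_mono) auto
    then have ak: "a k \<le> c ^ k" using k nonneg by simp
    \<comment> \<open>\<open>C\<close> absorbs the finitely many remainders \<open>r < k\<close>;
      the summand 1 keeps it positive, so that \<open>root n C\<close> tends to 1.\<close>
    define C where "C = 1 + (\<Sum>r<k. a r / c ^ r)"
    have C: "C > 0" using nonneg c0 by (auto simp: C_def intro!: add_pos_nonneg sum_nonneg)
    have base: "a r \<le> C * c ^ r" if "r < k" for r
    proof -
      have "a r / c ^ r \<le> (\<Sum>r<k. a r / c ^ r)"
        using that nonneg c0 by (intro member_le_sum) auto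
      then have "a r / c ^ r \<le> C" by (simp add: C_def)
      then show ?thesis using c0 by (simp add: field_simps)
    qed
    have step: "a (q * k + r) \<le> C * c ^ (q * k + r)" if "r < k" for q r
    proof (induction q)
      case 0
      then show ?case using base[OF that] by simp
    next
      case (Suc q)
      have "a (Suc q * k + r) \<le> a k * a (q * k + r)"
        using submult[of k "q * k + r"] by (simp add: add.assoc)
      also have "\<dots> \<le> c ^ k * (C * c ^ (q * k + r))"
        using ak Suc c0 nonneg by (intro mult_mono) auto
      finally show ?case by (simp add: power_add mult_ac)
    qed
    have bound: "a n \<le> C * c ^ n" for n
      using step[of "n mod k" "n div k"] k by simp
    have "(\<lambda>n. root n C * c) \<longlonglongrightarrow> 1 * c"
      using C by (intro tendsto_mult tendsto_const LIMSEQ_root_const)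
    then have "\<forall>\<^sub>F n in sequentially. root n C * c < y"
      using c by (intro order_tendstoD) auto
    moreover have "\<forall>\<^sub>F n in sequentially. n \<ge> (1::nat)" by (rule eventually_ge_at_top)
    ultimately show ?thesis
    proof eventually_elim
      case (elim n)
      have "root n (a n) \<le> root n (C * c ^ n)" using bound elim by simp
      also have "\<dots> = root n C * c" using elim c0 by (simp add: real_root_mult real_root_power_cancel)
      finally show ?case using elim by simp
    qed
  qed
  have "(\<lambda>n. root n (a n)) \<longlonglongrightarrow> L"
  proof (rule order_tendstoI)
    fix y assume "y < L"
    then show "\<forall>\<^sub>F n in sequentially. y < root n (a n)"
      by (intro eventually_mono[OF eventually_ge_at_top[of "1::nat"]]) (meson L_le less_le_trans)
  qed (rule upper)
  then show ?thesis by (rule convergentI)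
qed

text \<open>The exponent \<open>k * n + 1\<close> fits factorizations of powers that leave one
  factor \<open>S\<close> outside an \<open>n\<close>-fold product. If \<open>L ^ k > c\<close>,
  some \<open>d < L\<close> has \<open>d ^ k > c\<close>, and then
  \<open>d \<le> C * (c / d ^ k) ^ n\<close> for large \<open>n\<close>, which tends to 0.\<close>

lemma root_limit_power_le:
  fixes a :: "nat \<Rightarrow> real"
  assumes lim: "(\<lambda>n. root n (a n)) \<longlonglongrightarrow> L" and nonneg: "\<And>n. 0 \<le> a n"
    and k: "k > 0" and c: "0 \<le> c" and bound: "\<And>n. a (k * n + 1) \<le> C * c ^ n"
  shows "L ^ k \<le> c"
proof (rule ccontr)
  assume gt: "\<not> ?thesis"
  have L0: "0 \<le> L" by (rule LIMSEQ_le_const[OF lim]) (simp add: nonneg real_root_ge_zero)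
  define s where "s = root k c"
  have s: "0 \<le> s" "s ^ k = c" using c k by (simp_all add: s_def)
  have "s < L" using gt s L0 by (metis not_le power_mono)
  then obtain d where d: "s < d" "d < L" using dense by blast
  have d0: "d > 0" using d s by simp
  have cd: "c < d ^ k" using power_strict_mono[OF d(1) s(1) k] s by simp
  have sub: "filterlim (\<lambda>n. k * n + 1) sequentially sequentially"
    using k by (intro filterlim_subseq) (auto simp: strict_mono_def)
  have "\<forall>\<^sub>F n in sequentially. d < root n (a n)"
    by (rule order_tendstoD(1)[OF lim d(2)])
  then have "\<forall>\<^sub>F n in sequentially. d < root (k * n + 1) (a (k * n + 1))"
    using sub unfolding filterlim_iff by blast
  then have "\<forall>\<^sub>F n in sequentially. d \<le> C * (c / d ^ k) ^ n"
  proof eventually_elim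
    case (elim n)
    have "d ^ (k * n + 1) \<le> root (k * n + 1) (a (k * n + 1)) ^ (k * n + 1)"
      using elim d0 by (intro power_mono) auto
    also have "\<dots> = a (k * n + 1)" using nonneg by (intro real_root_pow_pos2) auto
    also have "\<dots> \<le> C * c ^ n" by (rule bound)
    finally have "d * (d ^ k) ^ n \<le> C * c ^ n" by (simp add: power_mult)
    then show ?case using d0 by (simp add: power_divide field_simps)
  qed
  moreover have "(\<lambda>n. C * (c / d ^ k) ^ n) \<longlonglongrightarrow> C * 0"
    using c cd d0 by (intro tendsto_mult tendsto_const LIMSEQ_power_zero) simp
  ultimately have "d \<le> C * 0" by (metis tendsto_lowerbound trivial_limit_sequentially)
  then show False using d0 by simp
qed

lemma linear_funpow:
  fixes f :: "'a::real_vector \<Rightarrow> 'a"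
  assumes "linear f"
  shows "linear (f ^^ n)"
proof (induction n)
  case (Suc n)
  show ?case unfolding funpow.simps by (rule linear_compose[OF Suc assms])
qed (simp add: linear_iff)

section \<open>Seminorms of the powers of an A-adjointable operator\<close>

context positive_form
begin

text \<open>The real bound \<open>c\<close> makes the extended seminorm finite, so
  \<open>enn2real\<close> does not turn infinity into 0.\<close>

lemma A_opnorm_real:
  assumes "linear T" and "0 \<le> c" and "\<And>z. A_norm A (T z) \<le> c * A_norm A z"
  shows "enn2real (A_opnorm A T) \<le> c"
    and "A_norm A (T z) \<le> enn2real (A_opnorm A T) * A_norm A z"
proof -
  have le: "A_opnorm A T \<le> ennreal c" by (rule A_opnorm_le[OF assms(3)])
  then show "enn2real (A_opnorm A T) \<le> c" using assms(2) by (simp add: enn2real_leI)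
  have "A_opnorm A T \<noteq> \<infinity>" using le by (auto simp: top_unique)
  then show "A_norm A (T z) \<le> enn2real (A_opnorm A T) * A_norm A z"
    by (rule A_norm_le_A_opnorm[OF assms(1)])
qed

context
  fixes S :: "'a \<Rightarrow> 'a"
  assumes S: "S \<in> A_adjointable A"
begin

interpretation S: bounded_linear S
  using S by (simp add: A_adjointable_def bounded_clinear_def)

lemma linear_pow: "linear (S ^^ n)"
  by (rule linear_funpow[OF S.linear_axioms])

lemma A_norm_funpow_bounded:
  obtains c where "0 \<le> c" and "\<And>z. A_norm A ((S ^^ n) z) \<le> c * A_norm A z"
proof -
  obtain c where c: "0 \<le> c" "\<And>z. A_norm A (S z) \<le> c * A_norm A z"
    using A_adjointable_bounded[OF S] by blast
  have "A_norm A ((S ^^ n) z) \<le> c ^ n * A_norm A z" for z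
  proof (induction n)
    case (Suc n)
    have "A_norm A (S ((S ^^ n) z)) \<le> c * A_norm A ((S ^^ n) z)" by (rule c)
    also have "\<dots> \<le> c * (c ^ n * A_norm A z)" using Suc c by (intro mult_left_mono)
    finally show ?case by (simp add: mult.assoc)
  qed simp
  then show thesis using that[of "c ^ n"] c by simp
qed

definition "pow_norm n = enn2real (A_opnorm A (S ^^ n))"

lemma pow_norm_nonneg: "0 \<le> pow_norm n"
  by (simp add: pow_norm_def)

lemma A_norm_funpow_le: "A_norm A ((S ^^ n) z) \<le> pow_norm n * A_norm A z"
  unfolding pow_norm_def by (metis A_norm_funpow_bounded A_opnorm_real(2) linear_pow)

lemma pow_norm_le:
  assumes "0 \<le> c" and "\<And>z. A_norm A ((S ^^ n) z) \<le> c * A_norm A z"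
  shows "pow_norm n \<le> c"
  unfolding pow_norm_def by (rule A_opnorm_real(1)[OF linear_pow assms])

text \<open>Submultiplicativity gives the convergence without which \<open>lim\<close> would carry
  no information.\<close>

lemma pow_norm_limit: "(\<lambda>n. root n (pow_norm n)) \<longlonglongrightarrow> A_spectral_radius A S"
proof -
  have "pow_norm (m + n) \<le> pow_norm m * pow_norm n" for m n
  proof (rule pow_norm_le)
    fix z
    have "A_norm A ((S ^^ m) ((S ^^ n) z)) \<le> pow_norm m * A_norm A ((S ^^ n) z)"
      by (rule A_norm_funpow_le)
    also have "\<dots> \<le> pow_norm m * (pow_norm n * A_norm A z)"
      by (intro mult_left_mono A_norm_funpow_le pow_norm_nonneg)
    finally show "A_norm A ((S ^^ (m + n)) z) \<le> pow_norm m * pow_norm n * A_norm A z"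
      by (simp add: funpow_add mult.assoc)
  qed (simp add: pow_norm_nonneg)
  then have "convergent (\<lambda>n. root n (pow_norm n))"
    by (intro root_submultiplicative_convergent pow_norm_nonneg)
  then show ?thesis
    unfolding A_spectral_radius_def pow_norm_def by (simp add: convergent_LIMSEQ_iff)
qed

lemma A_spectral_radius_power_le:
  assumes "k > 0" and "0 \<le> c" and "0 \<le> C"
    and "\<And>n z. A_norm A ((S ^^ (k * n + 1)) z) \<le> C * c ^ n * A_norm A z"
  shows "A_spectral_radius A S ^ k \<le> c"
  by (rule root_limit_power_le[OF pow_norm_limit pow_norm_nonneg assms(1,2), of C])
    (intro pow_norm_le assms(4) mult_nonneg_nonneg zero_le_power assms(2,3))

section \<open>Bounds on the spectral radius from factorizations of powers\<close>

context
  fixes X :: "'a \<Rightarrow> 'a"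
  assumes X: "linear X" and SXS: "\<And>z. S (X (S z)) = S z"
begin

text \<open>\<open>S X S = S\<close> gives \<open>S^(n+2) = (S^2 X) S^(n+1)\<close>. The innermost
  \<open>S\<close> contributes the constant \<open>pow_norm 1\<close>, which disappears in the limit
  of roots.\<close>

lemma A_spectral_radius_le_S2X:
  assumes fin: "A_opnorm A (S ^^ 2 \<circ> X) \<noteq> \<infinity>"
  shows "A_spectral_radius A S \<le> enn2real (A_opnorm A (S ^^ 2 \<circ> X))"
proof -
  define p where "p = enn2real (A_opnorm A (S ^^ 2 \<circ> X))"
  have step: "A_norm A (S (S (X z))) \<le> p * A_norm A z" for z
    using A_norm_le_A_opnorm[OF linear_compose[OF X linear_pow] fin]
    by (simp add: p_def numeral_2_eq_2)
  have "A_norm A ((S ^^ (n + 1)) z) \<le> pow_norm 1 * p ^ n * A_norm A z" for n z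
  proof (induction n)
    case 0
    then show ?case using A_norm_funpow_le[of 1 z] by simp
  next
    case (Suc n)
    have "A_norm A ((S ^^ (Suc n + 1)) z) = A_norm A (S (S (X ((S ^^ (n + 1)) z))))"
      by (simp add: SXS)
    also have "\<dots> \<le> p * (pow_norm 1 * p ^ n * A_norm A z)"
      using order_trans[OF step mult_left_mono[OF Suc, of p]] by (simp add: p_def)
    finally show ?case by (simp add: mult_ac)
  qed
  then have "A_spectral_radius A S ^ 1 \<le> p"
    by (intro A_spectral_radius_power_le[of 1 p "pow_norm 1"])
      (simp_all add: pow_norm_nonneg p_def)
  then show ?thesis by (simp add: p_def)
qed

text \<open>The mirror image \<open>S^(n+2) = S^(n+1) (X S^2)\<close>: the new factor acts on the
  argument first, so the induction varies \<open>z\<close>.\<close>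

lemma A_spectral_radius_le_XS2:
  assumes fin: "A_opnorm A (X \<circ> S ^^ 2) \<noteq> \<infinity>"
  shows "A_spectral_radius A S \<le> enn2real (A_opnorm A (X \<circ> S ^^ 2))"
proof -
  define q where "q = enn2real (A_opnorm A (X \<circ> S ^^ 2))"
  have step: "A_norm A (X (S (S z))) \<le> q * A_norm A z" for z
    using A_norm_le_A_opnorm[OF linear_compose[OF linear_pow X] fin]
    by (simp add: q_def numeral_2_eq_2)
  have "A_norm A ((S ^^ (n + 1)) z) \<le> pow_norm 1 * q ^ n * A_norm A z" for n z
  proof (induction n arbitrary: z)
    case 0
    then show ?case using A_norm_funpow_le[of 1 z] by simp
  next
    case (Suc n)
    have "A_norm A ((S ^^ (Suc n + 1)) z) = A_norm A ((S ^^ (n + 1)) (X (S (S z))))"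
      by (simp add: funpow_swap1 SXS)
    also have "\<dots> \<le> pow_norm 1 * q ^ n * A_norm A (X (S (S z)))" by (rule Suc)
    also have "\<dots> \<le> pow_norm 1 * q ^ n * (q * A_norm A z)"
      by (intro mult_left_mono step) (simp add: pow_norm_nonneg q_def)
    finally show ?case by (simp add: mult_ac)
  qed
  then have "A_spectral_radius A S ^ 1 \<le> q"
    by (intro A_spectral_radius_power_le[of 1 q "pow_norm 1"])
      (simp_all add: pow_norm_nonneg q_def)
  then show ?thesis by (simp add: q_def)
qed

text \<open>\<open>S^3 = S^2 (X S^2 X) S\<close>, so on the range of \<open>S\<close> each factor
  \<open>S^2 (X S^2 X)\<close> raises the exponent by two; hence the square.\<close>

lemma A_spectral_radius_square_le:
  assumes fin: "A_opnorm A (S ^^ 2) * A_opnorm A (X \<circ> S ^^ 2 \<circ> X) \<noteq> \<infinity>"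
  shows "(A_spectral_radius A S)\<^sup>2 \<le> enn2real (A_opnorm A (S ^^ 2) * A_opnorm A (X \<circ> S ^^ 2 \<circ> X))"
proof -
  define mt where "mt = enn2real (A_opnorm A (S ^^ 2) * A_opnorm A (X \<circ> S ^^ 2 \<circ> X))"
  have step: "A_norm A (S (S (S z))) \<le> mt * A_norm A (S z)" for z
  proof (cases "A_opnorm A (X \<circ> S ^^ 2 \<circ> X) = \<infinity>")
    case True
    \<comment> \<open>Then \<open>m t\<close> is finite only through \<open>0 * \<infinity> = 0\<close>.\<close>
    then have "A_opnorm A (S ^^ 2) = 0" using fin by (auto simp: ennreal_mult_eq_top_iff)
    then show ?thesis using A_norm_funpow_le[of 2 "S z"] by (simp add: numeral_2_eq_2 pow_norm_def mt_def)
  next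
    case False
    have "A_norm A (S (S (S z))) = A_norm A ((S ^^ 2) ((X \<circ> S ^^ 2 \<circ> X) (S z)))"
      by (simp add: numeral_2_eq_2 SXS)
    also have "\<dots> \<le> pow_norm 2 * A_norm A ((X \<circ> S ^^ 2 \<circ> X) (S z))"
      by (rule A_norm_funpow_le)
    also have "\<dots> \<le> pow_norm 2 * (enn2real (A_opnorm A (X \<circ> S ^^ 2 \<circ> X)) * A_norm A (S z))"
      by (intro mult_left_mono pow_norm_nonneg A_norm_le_A_opnorm[OF _ False] linear_compose X linear_pow)
    finally show ?thesis by (simp add: mt_def pow_norm_def enn2real_mult mult.assoc)
  qed
  have "A_norm A ((S ^^ (2 * n + 1)) z) \<le> pow_norm 1 * mt ^ n * A_norm A z" for n z
  proof (induction n)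
    case 0
    then show ?case using A_norm_funpow_le[of 1 z] by simp
  next
    case (Suc n)
    have "A_norm A ((S ^^ (2 * Suc n + 1)) z) \<le> mt * A_norm A ((S ^^ (2 * n + 1)) z)"
      using step[of "(S ^^ (2 * n)) z"] by simp
    also have "\<dots> \<le> mt * (pow_norm 1 * mt ^ n * A_norm A z)"
      by (intro mult_left_mono Suc) (simp add: mt_def)
    finally show ?case by (simp only: power_Suc mult_ac)
  qed
  then have "A_spectral_radius A S ^ 2 \<le> mt"
    by (intro A_spectral_radius_power_le[of 2 mt "pow_norm 1"])
      (simp_all add: pow_norm_nonneg mt_def)
  then show ?thesis by (simp add: mt_def)
qed

end

end

end

theorem corollary28:
  fixes A S :: "'a::chilbert_space \<Rightarrow> 'a"
  assumes "positive_operator A"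
    and "S \<in> A_adjointable A"
    and "closed (range S)"
  shows "let p = A_opnorm A ((S ^^ 2) \<circ> mp_inverse S);
             q = A_opnorm A (mp_inverse S \<circ> (S ^^ 2));
             m = A_opnorm A (S ^^ 2);
             t = A_opnorm A (mp_inverse S \<circ> (S ^^ 2) \<circ> mp_inverse S)
         in ennreal (A_spectral_radius A S) \<le>
              (if p = \<infinity> \<or> q = \<infinity> \<or> m * t = \<infinity> then \<infinity>
               else ennreal (1 / 4 * (sqrt ((enn2real p - enn2real q)\<^sup>2 + 4 * enn2real (m * t))
                                      + enn2real p + enn2real q)))"
proof -
  interpret positive_form A by (rule positive_form.intro) fact
  define X where "X = mp_inverse S"
  have "moore_penrose S X"
    unfolding X_def using assms by (intro moore_penrose_mp_inverse) (auto simp: A_adjointable_def)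
  then have X: "linear X" and SXS: "S (X (S z)) = S z" for z
    by (auto simp: moore_penrose_def bounded_clinear_def bounded_linear.linear fun_eq_iff)
  note bounds = A_spectral_radius_le_S2X[OF assms(2) X SXS] A_spectral_radius_le_XS2[OF assms(2) X SXS]
    A_spectral_radius_square_le[OF assms(2) X SXS]
  have key: "r \<le> 1 / 4 * (sqrt ((p - q)\<^sup>2 + 4 * c) + p + q)"
    if "r \<le> p" "r \<le> q" "r\<^sup>2 \<le> c" for r p q c :: real
  proof -
    have "(2 * r)\<^sup>2 \<le> (p - q)\<^sup>2 + 4 * c"
      using that(3) by (simp add: power_mult_distrib add_increasing)
    then have "2 * r \<le> sqrt ((p - q)\<^sup>2 + 4 * c)" by (rule real_le_rsqrt)
    then show ?thesis using that(1,2) by simp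
  qed
  show ?thesis
    unfolding Let_def X_def[symmetric]
  \<comment> \<open>An infinite right-hand side is trivial; otherwise the negated condition supplies
    the finiteness assumptions of the three bounds.\<close>
  proof (split if_split, intro conjI impI ennreal_leI key bounds)
  qed auto
qed

end
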